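(* Let $\mathcal{H}$ be a separable real Hilbert space, let $B,D$ be bounded linear operators on $\mathcal{H}$ with $B$ symmetric, nonnegative and nuclear, let $C=0$, and let $\alpha\in\mathbb{C}$. Then the solution $(s,P,Q,R)$, with $s:\mathbb{R}_+\to\mathbb{C}$ and $P,Q,R:\mathbb{R}_+\to L(\mathcal{H},\mathcal{H})$, of the system $$\begin{cases}s'=-\tfrac12 s\cdot\operatorname{tr}(CQ)+\alpha s,\\ P'=R^*CR,\\ Q'=B-QCQ+D^*Q+QD,\\ R'=-QCR+D^*R,\end{cases}\qquad\begin{cases}s(0)=1,\\ P(0)=0,\\ Q(0)=0,\\ R(0)=I\end{cases}$$ is given, for $t\ge0$, by $$s(t)=e^{\alpha t},\qquad P(t)\equiv0,\qquad Q(t)=\int_0^t\exp\{D^*\tau\}\,B\,\exp\{D\tau\}\,d\tau,\qquad R(t)=\exp\{D^*t\}.$$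
   Context: $\mathbb{R}_+=[0,\infty)$; $L(\mathcal{H},\mathcal{H})$ is the space of bounded linear operators on $\mathcal{H}$; $I$ is the identity operator. *)

theory Defs
  imports "HOL-Analysis.Analysis"
begin

type_synonym 'h op = "'h \<Rightarrow>\<^sub>L 'h"

text \<open>
  The library's \<open>adjoint\<close> is a choice of a function \<open>f'\<close> with \<open>f x \<bullet> y = x \<bullet> f' y\<close>. On a Hilbert space
  it exists, is unique and bounded, so that \<open>Blinfun\<close> is applied here to a bounded linear map.
\<close>

definition op_adjoint :: "'h :: {real_inner, banach} op \<Rightarrow> 'h op" where
  "op_adjoint A = Blinfun (adjoint (blinfun_apply A))"

text \<open>
  The library's \<open>exp\<close> is not available, since operators on a possibly trivial space are not an
  instance of \<open>real_normed_algebra_1\<close>. The series converges in operator norm.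
\<close>

definition op_exp :: "'h :: {real_inner, banach} op \<Rightarrow> 'h op" where
  "op_exp A = (\<Sum>n. (1 / fact n) *\<^sub>R (((o\<^sub>L) A ^^ n) id_blinfun))"

definition op_symmetric :: "'h :: {real_inner, banach} op \<Rightarrow> bool" where
  "op_symmetric A \<longleftrightarrow> (\<forall>x y. A x \<bullet> y = x \<bullet> A y)"

definition op_nonneg :: "'h :: {real_inner, banach} op \<Rightarrow> bool" where
  "op_nonneg A \<longleftrightarrow> (\<forall>x. 0 \<le> A x \<bullet> x)"

definition op_nuclear :: "'h :: {real_inner, banach} op \<Rightarrow> bool" where
  "op_nuclear A \<longleftrightarrow> (\<exists>a b :: nat \<Rightarrow> 'h.
     summable (\<lambda>n. norm (a n) * norm (b n)) \<and> (\<forall>x. (\<lambda>n. (a n \<bullet> x) *\<^sub>R b n) sums A x))"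

definition orthonormal_basis :: "'h :: {real_inner, banach} set \<Rightarrow> bool" where
  "orthonormal_basis E \<longleftrightarrow>
     pairwise orthogonal E \<and> (\<forall>e\<in>E. norm e = 1) \<and> closure (span E) = UNIV"

text \<open>For nuclear \<open>A\<close> the sum converges absolutely and does not depend on the chosen basis.\<close>

definition op_trace :: "'h :: {real_inner, banach} op \<Rightarrow> real" where
  "op_trace A = (\<Sum>\<^sub>\<infinity>e\<in>(SOME E. orthonormal_basis E). A e \<bullet> e)"

text \<open>
  Functions on \<open>[0, \<infinity>)\<close> are modelled by functions on the reals of which only the values at
  arguments \<open>t \<ge> 0\<close> matter; derivatives are one-sided at \<open>0\<close>, and taken in operator norm for
  \<open>P\<close>, \<open>Q\<close>, \<open>R\<close>. That the product \<open>C Q(t)\<close> is nuclear is what makes the trace in the first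
  equation meaningful.
\<close>

definition riccati_solution ::
  "'h :: {real_inner, banach} op \<Rightarrow> 'h op \<Rightarrow> 'h op \<Rightarrow> complex \<Rightarrow>
   (real \<Rightarrow> complex) \<Rightarrow> (real \<Rightarrow> 'h op) \<Rightarrow> (real \<Rightarrow> 'h op) \<Rightarrow> (real \<Rightarrow> 'h op) \<Rightarrow> bool" where
  "riccati_solution B C D \<alpha> s P Q R \<longleftrightarrow>
     (\<forall>t\<ge>0.
        op_nuclear (C o\<^sub>L Q t) \<and>
        (s has_vector_derivative
           - (1/2) * s t * complex_of_real (op_trace (C o\<^sub>L Q t)) + \<alpha> * s t) (at t within {0..}) \<and>
        (P has_vector_derivative
           op_adjoint (R t) o\<^sub>L C o\<^sub>L R t) (at t within {0..}) \<and>
        (Q has_vector_derivative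
           B - (Q t o\<^sub>L C o\<^sub>L Q t) + (op_adjoint D o\<^sub>L Q t) + (Q t o\<^sub>L D)) (at t within {0..}) \<and>
        (R has_vector_derivative
           - (Q t o\<^sub>L C o\<^sub>L R t) + (op_adjoint D o\<^sub>L R t)) (at t within {0..})) \<and>
     s 0 = 1 \<and> P 0 = 0 \<and> Q 0 = 0 \<and> R 0 = id_blinfun"

end

theory Submission
  imports Defs
begin

text \<open>
  For \<open>C = 0\<close> the Riccati system decouples into linear equations. Writing \<open>A\<close> for the adjoint of
  \<open>D\<close>, they read \<open>s' = \<alpha> s\<close>, \<open>P' = 0\<close>, \<open>Q' = B + A Q + Q D\<close> and \<open>R' = A R\<close>. The proof
  needs two ingredients, both about the operator exponential \<open>E\<^sub>A(t) = exp (t A)\<close>.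

  \<^item> Its derivative is \<open>A E\<^sub>A(t) = E\<^sub>A(t) A\<close>, by differentiating the power series term by term
    (\<open>op_exp_has_vector_derivative\<close>, \<open>op_exp_commute\<close>). Consequently \<open>E\<^sub>A(-t)\<close> is an inverse
    of \<open>E\<^sub>A(t)\<close> (\<open>op_exp_inverse\<close>).

  \<^item> The homogeneous Sylvester equation \<open>W' = A W + W D\<close> with \<open>W(0) = 0\<close> has only the zero
    solution, because \<open>E\<^sub>A(-t) W(t) E\<^sub>D(-t)\<close> has derivative zero and the exponentials are
    invertible (\<open>sylvester_ode_zero_unique\<close>).

  The integrand \<open>F(t) = E\<^sub>A(t) B E\<^sub>D(t)\<close> solves that equation with \<open>F(0) = B\<close>. Integrating
  it from \<open>0\<close> to \<open>t\<close> gives \<open>F(t) - B = A Q(t) + Q(t) D\<close> for \<open>Q\<close> the integral of \<open>F\<close>, and since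
  \<open>Q' = F\<close> this is the equation for \<open>Q\<close>
  (\<open>sylvester_ode_integral_solution\<close>). Hence the stated functions solve the system. Conversely,
  for \<open>Q\<close> and \<open>R\<close> the difference between any solution and the stated one satisfies a homogeneous
  Sylvester equation (for \<open>R\<close>, with \<open>D\<close> replaced by \<open>0\<close>), hence vanishes; for the scalar equation
  of \<open>s\<close> the same integrating-factor argument applies, and \<open>P\<close> is constant.
\<close>

section \<open>The exponential series of an operator\<close>

interpretation blinfun_compose: bounded_bilinear "(o\<^sub>L)"
  by (rule bounded_bilinear_blinfun_compose)

lemma blinfun_compose_assoc: "(A o\<^sub>L B) o\<^sub>L C = A o\<^sub>L (B o\<^sub>L C)"
  by (auto intro: blinfun_eqI)

abbreviation op_power :: "'h :: {real_inner, banach} op \<Rightarrow> nat \<Rightarrow> 'h op" where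
  "op_power A n \<equiv> ((o\<^sub>L) A ^^ n) id_blinfun"

lemma op_power_scaleR: "op_power (t *\<^sub>R A) n = t ^ n *\<^sub>R op_power A n"
  by (induction n) (simp_all add: blinfun_compose.scaleR_left blinfun_compose.scaleR_right mult.commute)

lemma op_power_commute: "A o\<^sub>L op_power A n = op_power A n o\<^sub>L A"
proof (induction n)
  case 0
  show ?case by (auto intro: blinfun_eqI)
next
  case (Suc n)
  from arg_cong[OF this, of "(o\<^sub>L) A"] show ?case
    by (simp add: blinfun_compose_assoc)
qed

lemma norm_op_power_le: "norm (op_power A n) \<le> norm A ^ n"
proof (induction n)
  case 0
  show ?case by (simp add: norm_blinfun_id_le)
next
  case (Suc n)
  have "norm (A o\<^sub>L op_power A n) \<le> norm A * norm (op_power A n)"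
    by (rule norm_blinfun_compose)
  also have "\<dots> \<le> norm A * norm A ^ n"
    using Suc by (intro mult_left_mono) auto
  finally show ?case by simp
qed

lemma op_exp_scaleR_sums:
  "(\<lambda>n. (t ^ n / fact n) *\<^sub>R op_power A n) sums op_exp (t *\<^sub>R A)"
proof -
  have "summable (\<lambda>n. (t ^ n / fact n) *\<^sub>R op_power A n)"
  proof (rule summable_comparison_test)
    show "\<exists>N. \<forall>n\<ge>N. norm ((t ^ n / fact n) *\<^sub>R op_power A n) \<le> inverse (fact n) * (\<bar>t\<bar> * norm A) ^ n"
      using norm_op_power_le[where A = A]
      by (auto simp: power_abs power_mult_distrib field_simps intro!: mult_left_mono)
    show "summable (\<lambda>n. inverse (fact n) * (\<bar>t\<bar> * norm A) ^ n)"
      by (rule summable_exp)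
  qed
  then show ?thesis
    by (simp add: op_exp_def op_power_scaleR summable_sums)
qed

lemma op_exp_0 [simp]: "op_exp (0 :: 'h :: {real_inner, banach} op) = id_blinfun"
proof -
  have "(\<lambda>n. (0 ^ n / fact n) *\<^sub>R op_power (0 :: 'h op) n) sums id_blinfun"
    using sums_finite[of "{0}" "\<lambda>n. (0 ^ n / fact n) *\<^sub>R op_power (0 :: 'h op) n"]
    by (simp add: power_0_left)
  with op_exp_scaleR_sums[of 0 "0 :: 'h op"] show ?thesis
    by (simp add: sums_unique2)
qed

lemma op_exp_commute: "A o\<^sub>L op_exp (t *\<^sub>R A) = op_exp (t *\<^sub>R A) o\<^sub>L A"
proof -
  have "(\<lambda>n. A o\<^sub>L (t ^ n / fact n) *\<^sub>R op_power A n) sums (A o\<^sub>L op_exp (t *\<^sub>R A))"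
    by (intro bounded_linear.sums[OF blinfun_compose.bounded_linear_right] op_exp_scaleR_sums)
  moreover have "(\<lambda>n. (t ^ n / fact n) *\<^sub>R op_power A n o\<^sub>L A) sums (op_exp (t *\<^sub>R A) o\<^sub>L A)"
    by (intro bounded_linear.sums[OF blinfun_compose.bounded_linear_left] op_exp_scaleR_sums)
  ultimately show ?thesis
    by (simp add: blinfun_compose.scaleR_left blinfun_compose.scaleR_right op_power_commute sums_unique2)
qed

text \<open>
  The differentiated series is, up to a shift of the index, the exponential series composed with
  \<open>A\<close>. It converges uniformly on bounded intervals, so the term-by-term derivative is the derivative.
\<close>

lemma op_exp_has_vector_derivative:
  "((\<lambda>t. op_exp (t *\<^sub>R A)) has_vector_derivative A o\<^sub>L op_exp (t *\<^sub>R A)) (at t within T)"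
proof -
  define r where "r = \<bar>t\<bar> + 1"
  define S where "S = ball (0 :: real) r"
  define f where "f n x = (x ^ n / fact n) *\<^sub>R op_power A n" for n :: nat and x :: real
  define f' where "f' n x = (real n * x ^ (n - 1) / fact n) *\<^sub>R op_power A n" for n :: nat and x :: real
  have f'_Suc: "f' (Suc n) x = A o\<^sub>L f n x" for n x
    by (simp add: f_def f'_def blinfun_compose.scaleR_right divide_simps del: of_nat_Suc)
  have f_sums: "(\<lambda>n. f n x) sums op_exp (x *\<^sub>R A)" for x
    unfolding f_def by (rule op_exp_scaleR_sums)
  have f'_sums: "(\<lambda>n. f' n x) sums (A o\<^sub>L op_exp (x *\<^sub>R A))" for x
  proof -
    have "(\<lambda>n. f' (Suc n) x) sums (A o\<^sub>L op_exp (x *\<^sub>R A))"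
      unfolding f'_Suc by (intro bounded_linear.sums[OF blinfun_compose.bounded_linear_right] f_sums)
    moreover have "f' 0 x = 0"
      by (simp add: f'_def)
    ultimately show ?thesis
      using sums_Suc_iff[of "\<lambda>n. f' n x"] by simp
  qed
  \<comment> \<open>The terms of the exponential series at \<open>r * norm A\<close>, shifted and scaled like \<open>f'\<close>.\<close>
  define M where "M n = (case n of 0 \<Rightarrow> 0 | Suc m \<Rightarrow> norm A * (inverse (fact m) * (r * norm A) ^ m))"
    for n :: nat
  have "norm (f' n x) \<le> M n" if "x \<in> S" for n x
  proof (cases n)
    case 0
    then show ?thesis by (simp add: f'_def M_def)
  next
    case (Suc m)
    have "norm (f m x) = \<bar>x\<bar> ^ m / fact m * norm (op_power A m)"
      by (simp add: f_def power_abs)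
    also have "\<dots> \<le> r ^ m / fact m * norm A ^ m"
      using that norm_op_power_le[where A = A and n = m] unfolding S_def
      by (intro mult_mono divide_right_mono power_mono) (auto simp: r_def)
    finally have "norm (f m x) \<le> inverse (fact m) * (r * norm A) ^ m"
      by (simp add: power_mult_distrib field_simps)
    then have "norm A * norm (f m x) \<le> M n"
      by (simp add: Suc M_def mult_left_mono)
    with norm_blinfun_compose[of A "f m x"] show ?thesis
      by (simp add: Suc f'_Suc)
  qed
  moreover have "summable M"
  proof -
    have "summable (\<lambda>m. M (Suc m))"
      unfolding M_def by (simp only: nat.case) (intro summable_mult summable_exp)
    then show ?thesis by (simp only: summable_Suc_iff)
  qed
  ultimately have "uniform_limit S (\<lambda>n x. \<Sum>i<n. f' i x) (\<lambda>x. \<Sum>i. f' i x) sequentially"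
    by (intro Weierstrass_m_test_ev always_eventually) auto
  then have lim: "uniform_limit S (\<lambda>n x. \<Sum>i<n. f' i x) (\<lambda>x. A o\<^sub>L op_exp (x *\<^sub>R A)) sequentially"
    by (simp only: sums_unique[OF f'_sums])
  have "\<exists>g. \<forall>x\<in>S. (\<lambda>n. f n x) sums g x \<and>
      (g has_derivative (\<lambda>h. h *\<^sub>R (A o\<^sub>L op_exp (x *\<^sub>R A)))) (at x within S)"
  proof (rule has_derivative_series)
    show "(f n has_derivative (\<lambda>h. h *\<^sub>R f' n x)) (at x within S)" for n x
      unfolding f_def f'_def
      by (auto intro!: derivative_eq_intros simp: field_simps)
    show "\<forall>\<^sub>F n in sequentially. \<forall>x\<in>S. \<forall>h.
        norm ((\<Sum>i<n. h *\<^sub>R f' i x) - h *\<^sub>R (A o\<^sub>L op_exp (x *\<^sub>R A))) \<le> e * norm h"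
      if "e > 0" for e
      using uniform_limitD[OF lim that]
    proof eventually_elim
      case (elim n)
      show ?case
      proof (intro ballI allI)
        fix x h :: real
        assume "x \<in> S"
        have "(\<Sum>i<n. h *\<^sub>R f' i x) - h *\<^sub>R (A o\<^sub>L op_exp (x *\<^sub>R A)) =
            h *\<^sub>R ((\<Sum>i<n. f' i x) - (A o\<^sub>L op_exp (x *\<^sub>R A)))"
          by (simp add: scaleR_right_diff_distrib scaleR_sum_right)
        then have "norm ((\<Sum>i<n. h *\<^sub>R f' i x) - h *\<^sub>R (A o\<^sub>L op_exp (x *\<^sub>R A))) =
            \<bar>h\<bar> * dist (\<Sum>i<n. f' i x) (A o\<^sub>L op_exp (x *\<^sub>R A))"
          by (simp add: dist_norm)
        also have "\<dots> \<le> \<bar>h\<bar> * e"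
          using elim \<open>x \<in> S\<close> by (intro mult_left_mono) (auto intro: less_imp_le)
        finally show "norm ((\<Sum>i<n. h *\<^sub>R f' i x) - h *\<^sub>R (A o\<^sub>L op_exp (x *\<^sub>R A))) \<le> e * norm h"
          by (simp add: mult.commute)
      qed
    qed
    show "convex S" "0 \<in> S" "(\<lambda>n. f n 0) sums op_exp (0 *\<^sub>R A)"
      using f_sums[of 0] by (auto simp: S_def r_def)
  qed
  then obtain g where g: "(\<lambda>n. f n x) sums g x"
      "(g has_derivative (\<lambda>h. h *\<^sub>R (A o\<^sub>L op_exp (x *\<^sub>R A)))) (at x within S)" if "x \<in> S" for x
    by blast
  have "open S" and "t \<in> S"
    by (auto simp: S_def r_def)
  have "((\<lambda>x. op_exp (x *\<^sub>R A)) has_derivative (\<lambda>h. h *\<^sub>R (A o\<^sub>L op_exp (t *\<^sub>R A)))) (at t)"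
  proof (rule has_derivative_transform_within_open[OF _ \<open>open S\<close> \<open>t \<in> S\<close>])
    show "(g has_derivative (\<lambda>h. h *\<^sub>R (A o\<^sub>L op_exp (t *\<^sub>R A)))) (at t)"
      using g(2)[OF \<open>t \<in> S\<close>] at_within_open[OF \<open>t \<in> S\<close> \<open>open S\<close>] by simp
    show "g x = op_exp (x *\<^sub>R A)" if "x \<in> S" for x
      using g(1)[OF that] f_sums[of x] by (rule sums_unique2)
  qed
  then show ?thesis
    unfolding has_vector_derivative_def by (rule has_derivative_at_withinI)
qed

lemma op_exp_neg_has_vector_derivative:
  "((\<lambda>t. op_exp ((- t) *\<^sub>R A)) has_vector_derivative - (A o\<^sub>L op_exp ((- t) *\<^sub>R A))) (at t within T)"
  using op_exp_has_vector_derivative[of "- A" t T]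
  by (simp add: blinfun_compose.minus_left)

text \<open>
  The product is constant in \<open>t\<close> because its derivative vanishes. The argument avoids the addition
  theorem and its Cauchy product of series.
\<close>

lemma op_exp_inverse: "op_exp (t *\<^sub>R A) o\<^sub>L op_exp ((- t) *\<^sub>R A) = id_blinfun"
proof -
  have "((\<lambda>t. op_exp (t *\<^sub>R A) o\<^sub>L op_exp ((- t) *\<^sub>R A)) has_vector_derivative 0) (at t within UNIV)" for t
  proof -
    have "op_exp (t *\<^sub>R A) o\<^sub>L (A o\<^sub>L op_exp ((- t) *\<^sub>R A)) =
        (A o\<^sub>L op_exp (t *\<^sub>R A)) o\<^sub>L op_exp ((- t) *\<^sub>R A)"
      by (simp add: op_exp_commute blinfun_compose_assoc)
    then show ?thesis
      using blinfun_compose.has_vector_derivative[OF op_exp_has_vector_derivative[of A t UNIV]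
          op_exp_neg_has_vector_derivative[of A t UNIV]]
      by (simp add: blinfun_compose.minus_right)
  qed
  then obtain c where "op_exp (t *\<^sub>R A) o\<^sub>L op_exp ((- t) *\<^sub>R A) = c" for t
    using has_vector_derivative_zero_constant[of UNIV] by (metis (no_types, lifting) UNIV_I convex_UNIV)
  from this[of t] this[of 0] have "op_exp (t *\<^sub>R A) o\<^sub>L op_exp ((- t) *\<^sub>R A) = id_blinfun o\<^sub>L id_blinfun"
    by simp
  then show ?thesis
    by (auto intro: blinfun_eqI)
qed

section \<open>The Sylvester equation\<close>

text \<open>
  Multiplying by the integrating factors \<open>exp (- t A)\<close> on the left and \<open>exp (- t D)\<close> on the right
  turns a solution into a function with zero derivative; as the factors are invertible, vanishing
  of that function forces \<open>W\<close> to vanish.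
\<close>

lemma sylvester_ode_zero_unique:
  fixes W :: "real \<Rightarrow> 'h :: {real_inner, banach} op"
  assumes W: "\<And>t. t \<ge> 0 \<Longrightarrow> (W has_vector_derivative (A o\<^sub>L W t) + (W t o\<^sub>L D)) (at t within {0..})"
    and "W 0 = 0" and "t \<ge> 0"
  shows "W t = 0"
proof -
  define V where "V t = op_exp ((- t) *\<^sub>R A) o\<^sub>L (W t o\<^sub>L op_exp ((- t) *\<^sub>R D))" for t
  have "(V has_vector_derivative 0) (at t within {0..})" if "t \<in> {0..}" for t
  proof -
    let ?a = "op_exp ((- t) *\<^sub>R A)" and ?d = "op_exp ((- t) *\<^sub>R D)"
    have "t \<ge> 0" using that by simp
    note blinfun_compose.has_vector_derivative[OF op_exp_neg_has_vector_derivative[of A]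
        blinfun_compose.has_vector_derivative[OF W[OF \<open>t \<ge> 0\<close>] op_exp_neg_has_vector_derivative[of D]]]
    moreover have "(?a o\<^sub>L ((W t o\<^sub>L - (D o\<^sub>L ?d)) + ((A o\<^sub>L W t) + (W t o\<^sub>L D) o\<^sub>L ?d))) +
        (- (A o\<^sub>L ?a) o\<^sub>L (W t o\<^sub>L ?d)) = 0"
      by (simp only: op_exp_commute[of A "- t"])
        (simp add: blinfun_compose.minus_left blinfun_compose.minus_right blinfun_compose.add_left
          blinfun_compose.add_right blinfun_compose_assoc)
    ultimately show ?thesis
      unfolding V_def by simp
  qed
  then obtain c where c: "V t = c" if "t \<in> {0..}" for t
    using has_vector_derivative_zero_constant[of "{0..}" V] by auto
  have "V t = 0"
    using c[of t] c[of 0] \<open>W 0 = 0\<close> \<open>t \<ge> 0\<close> by (simp add: V_def)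
  \<comment> \<open>The right factor uses the inverse law at \<open>- t\<close>, which puts \<open>exp (- t D)\<close> next to \<open>W t\<close>.\<close>
  have "W t = (op_exp (t *\<^sub>R A) o\<^sub>L op_exp ((- t) *\<^sub>R A)) o\<^sub>L W t o\<^sub>L
      (op_exp ((- t) *\<^sub>R D) o\<^sub>L op_exp ((- (- t)) *\<^sub>R D))"
    unfolding op_exp_inverse by (auto intro: blinfun_eqI)
  also have "\<dots> = op_exp (t *\<^sub>R A) o\<^sub>L V t o\<^sub>L op_exp ((- (- t)) *\<^sub>R D)"
    by (simp add: V_def blinfun_compose_assoc)
  finally show ?thesis
    by (simp add: \<open>V t = 0\<close>)
qed

lemma op_exp_conjugation_has_vector_derivative:
  "((\<lambda>t. op_exp (t *\<^sub>R A) o\<^sub>L B o\<^sub>L op_exp (t *\<^sub>R D)) has_vector_derivative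
     (A o\<^sub>L (op_exp (t *\<^sub>R A) o\<^sub>L B o\<^sub>L op_exp (t *\<^sub>R D))) +
     ((op_exp (t *\<^sub>R A) o\<^sub>L B o\<^sub>L op_exp (t *\<^sub>R D)) o\<^sub>L D)) (at t within T)"
proof -
  note blinfun_compose.has_vector_derivative[OF
      blinfun_compose.has_vector_derivative[OF op_exp_has_vector_derivative[of A]
        has_vector_derivative_const[of B]] op_exp_has_vector_derivative[of D]]
  then show ?thesis
    by (simp add: op_exp_commute[of D] blinfun_compose_assoc add.commute)
qed

text \<open>
  The integrand solves the homogeneous equation with initial value \<open>B\<close>; integrating that equation
  shows that its integral solves the inhomogeneous one.
\<close>

lemma sylvester_ode_integral_solution:
  fixes A B D :: "'h :: {real_inner, banach} op"
  defines "F \<equiv> \<lambda>t. op_exp (t *\<^sub>R A) o\<^sub>L B o\<^sub>L op_exp (t *\<^sub>R D)"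
  defines "Q \<equiv> \<lambda>t. integral {0..t} F"
  assumes "t \<ge> 0"
  shows "(Q has_vector_derivative B + (A o\<^sub>L Q t) + (Q t o\<^sub>L D)) (at t within {0..})"
proof -
  have F': "(F has_vector_derivative (A o\<^sub>L F u) + (F u o\<^sub>L D)) (at u within T)" for u T
    unfolding F_def by (rule op_exp_conjugation_has_vector_derivative)
  have cont: "continuous_on T F" for T
    unfolding continuous_on_eq_continuous_within
    by (intro ballI has_vector_derivative_continuous[OF F'])
  have "(F has_integral Q t) {0..t}"
    unfolding Q_def by (intro integrable_integral integrable_continuous_real cont)
  then have "((\<lambda>u. (A o\<^sub>L F u) + (F u o\<^sub>L D)) has_integral (A o\<^sub>L Q t) + (Q t o\<^sub>L D)) {0..t}"
    using has_integral_linear[OF _ blinfun_compose.bounded_linear_right[of A]]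
      has_integral_linear[OF _ blinfun_compose.bounded_linear_left[of D]]
    by (intro has_integral_add) (auto simp: o_def)
  moreover have "((\<lambda>u. (A o\<^sub>L F u) + (F u o\<^sub>L D)) has_integral F t - F 0) {0..t}"
    using \<open>t \<ge> 0\<close> F' by (rule fundamental_theorem_of_calculus)
  ultimately have "(A o\<^sub>L Q t) + (Q t o\<^sub>L D) = F t - F 0"
    by (rule has_integral_unique)
  moreover have "F 0 = B"
    by (auto simp: F_def intro: blinfun_eqI)
  ultimately have "F t = B + (A o\<^sub>L Q t) + (Q t o\<^sub>L D)"
    by (simp add: algebra_simps)
  moreover have "(Q has_vector_derivative F t) (at t within {0..})"
  proof -
    have "(Q has_vector_derivative F t) (at t within {0..t + 1})"
      unfolding Q_def using \<open>t \<ge> 0\<close> by (intro integral_has_vector_derivative cont) auto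
    \<comment> \<open>Near \<open>t\<close> the half-line and the interval \<open>[0, t + 1]\<close> coincide.\<close>
    moreover have "at t within {0..t + 1} = at t within {0..}"
      by (rule at_within_nhd[where S = "{..<t + 1}"]) auto
    ultimately show ?thesis by simp
  qed
  ultimately show ?thesis by simp
qed

section \<open>The decoupled system\<close>

lemma exp_linear_has_vector_derivative:
  "((\<lambda>t. exp (\<alpha> * complex_of_real t)) has_vector_derivative \<alpha> * exp (\<alpha> * complex_of_real t))
     (at t within T)"
  by (rule has_vector_derivative_real_field) (auto intro!: derivative_eq_intros)

lemma complex_linear_ode_unique:
  fixes s :: "real \<Rightarrow> complex"
  assumes s: "\<And>t. t \<ge> 0 \<Longrightarrow> (s has_vector_derivative \<alpha> * s t) (at t within {0..})"
    and "t \<ge> 0"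
  shows "s t = s 0 * exp (\<alpha> * complex_of_real t)"
proof -
  have "((\<lambda>t. s t * exp (- \<alpha> * complex_of_real t)) has_vector_derivative 0) (at t within {0..})"
    if "t \<in> {0..}" for t
  proof -
    have "((\<lambda>t. exp (- \<alpha> * complex_of_real t)) has_vector_derivative
        - \<alpha> * exp (- \<alpha> * complex_of_real t)) (at t within {0..})"
      by (rule exp_linear_has_vector_derivative)
    from has_vector_derivative_mult[OF s this] that show ?thesis
      by (simp add: algebra_simps)
  qed
  then obtain c where "s t * exp (- \<alpha> * complex_of_real t) = c" if "t \<in> {0..}" for t
    using has_vector_derivative_zero_constant[of "{0..}"] by (metis (no_types, lifting) convex_real_interval(1))
  from this[of t] this[of 0] \<open>t \<ge> 0\<close> have "s t * exp (- \<alpha> * complex_of_real t) = s 0"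
    by simp
  then show ?thesis
    by (simp add: exp_minus field_simps)
qed

text \<open>
  With \<open>C = 0\<close> every composite containing \<open>C\<close> vanishes; in particular the trace term is the trace
  of the zero operator, which is nuclear with trace zero.
\<close>

lemma riccati_solution_zero_iff:
  "riccati_solution B 0 D \<alpha> s P Q R \<longleftrightarrow>
     (\<forall>t\<ge>0.
        (s has_vector_derivative \<alpha> * s t) (at t within {0..}) \<and>
        (P has_vector_derivative 0) (at t within {0..}) \<and>
        (Q has_vector_derivative B + (op_adjoint D o\<^sub>L Q t) + (Q t o\<^sub>L D)) (at t within {0..}) \<and>
        (R has_vector_derivative op_adjoint D o\<^sub>L R t) (at t within {0..})) \<and>
     s 0 = 1 \<and> P 0 = 0 \<and> Q 0 = 0 \<and> R 0 = id_blinfun"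
proof -
  have "op_nuclear (0 :: 'a op)"
    unfolding op_nuclear_def by (intro exI[of _ "\<lambda>_. 0"]) auto
  moreover have "op_trace (0 :: 'a op) = 0"
    by (simp add: op_trace_def)
  ultimately show ?thesis
    by (simp add: riccati_solution_def)
qed

theorem theorem3:
  fixes B C D :: "'h :: {real_inner, banach} op"
    and \<alpha> :: complex
    and s :: "real \<Rightarrow> complex"
    and P Q R :: "real \<Rightarrow> 'h op"
  assumes "separable_space (euclidean :: 'h topology)"
    and "op_symmetric B" and "op_nonneg B" and "op_nuclear B"
    and "C = 0"
  shows "riccati_solution B C D \<alpha> s P Q R \<longleftrightarrow>
    (\<forall>t\<ge>0. s t = exp (\<alpha> * complex_of_real t) \<and>
           P t = 0 \<and>
           Q t = integral {0..t} (\<lambda>\<tau>. op_exp (\<tau> *\<^sub>R op_adjoint D) o\<^sub>L B o\<^sub>L op_exp (\<tau> *\<^sub>R D)) \<and>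
           R t = op_exp (t *\<^sub>R op_adjoint D))"
    (is "_ \<longleftrightarrow> (\<forall>t\<ge>0. s t = ?s t \<and> P t = 0 \<and> Q t = ?Q t \<and> R t = ?R t)")
proof -
  let ?A = "op_adjoint D"
  have s': "(?s has_vector_derivative \<alpha> * ?s t) (at t within {0..})" for t
    by (rule exp_linear_has_vector_derivative)
  have Q': "(?Q has_vector_derivative B + (?A o\<^sub>L ?Q t) + (?Q t o\<^sub>L D)) (at t within {0..})"
    if "t \<ge> 0" for t
    using that by (rule sylvester_ode_integral_solution)
  have R': "(?R has_vector_derivative ?A o\<^sub>L ?R t) (at t within {0..})" for t
    by (rule op_exp_has_vector_derivative)
  show ?thesis
    unfolding \<open>C = 0\<close> riccati_solution_zero_iff
  proof (intro iffI allI impI; (elim conjE)?)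
    fix t :: real
    assume "t \<ge> 0" and s0: "s 0 = 1" and P0: "P 0 = 0" and Q0: "Q 0 = 0" and R0: "R 0 = id_blinfun"
      and sol: "\<forall>t\<ge>0.
        (s has_vector_derivative \<alpha> * s t) (at t within {0..}) \<and>
        (P has_vector_derivative 0) (at t within {0..}) \<and>
        (Q has_vector_derivative B + (?A o\<^sub>L Q t) + (Q t o\<^sub>L D)) (at t within {0..}) \<and>
        (R has_vector_derivative ?A o\<^sub>L R t) (at t within {0..})"
    have "s t = ?s t"
      using complex_linear_ode_unique[of s \<alpha> t] sol s0 \<open>t \<ge> 0\<close> by simp
    moreover obtain c where "P t = c" if "t \<in> {0..}" for t
      using has_vector_derivative_zero_constant[of "{0..}" P] sol by auto
    then have "P t = 0"
      using P0 \<open>t \<ge> 0\<close> by (metis atLeast_iff order_refl)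
    moreover have "Q t - ?Q t = 0"
    proof (rule sylvester_ode_zero_unique[OF _ _ \<open>t \<ge> 0\<close>])
      fix u :: real
      assume "u \<ge> 0"
      with sol have "(Q has_vector_derivative B + (?A o\<^sub>L Q u) + (Q u o\<^sub>L D)) (at u within {0..})"
        by blast
      from has_vector_derivative_diff[OF this Q'[OF \<open>u \<ge> 0\<close>]]
      show "((\<lambda>t. Q t - ?Q t) has_vector_derivative
          (?A o\<^sub>L (Q u - ?Q u)) + ((Q u - ?Q u) o\<^sub>L D)) (at u within {0..})"
        by (simp add: blinfun_compose.diff_left blinfun_compose.diff_right algebra_simps)
    qed (simp add: Q0)
    \<comment> \<open>A one-sided equation is a Sylvester equation with right coefficient zero.\<close>
    moreover have "R t - ?R t = 0"
    proof (rule sylvester_ode_zero_unique[OF _ _ \<open>t \<ge> 0\<close>])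
      fix u :: real
      assume "u \<ge> 0"
      with sol have "(R has_vector_derivative ?A o\<^sub>L R u) (at u within {0..})"
        by blast
      from has_vector_derivative_diff[OF this R']
      show "((\<lambda>t. R t - ?R t) has_vector_derivative
          (?A o\<^sub>L (R u - ?R u)) + ((R u - ?R u) o\<^sub>L 0)) (at u within {0..})"
        by (simp add: blinfun_compose.diff_right)
    qed (simp add: R0)
    ultimately show "s t = ?s t \<and> P t = 0 \<and> Q t = ?Q t \<and> R t = ?R t"
      by simp
  next
    assume eq: "\<forall>t\<ge>0. s t = ?s t \<and> P t = 0 \<and> Q t = ?Q t \<and> R t = ?R t"
    \<comment> \<open>Only values on the half-line are known, which is enough for derivatives within it.\<close>
    have "(s has_vector_derivative \<alpha> * s t) (at t within {0..}) \<and>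
        (P has_vector_derivative 0) (at t within {0..}) \<and>
        (Q has_vector_derivative B + (?A o\<^sub>L Q t) + (Q t o\<^sub>L D)) (at t within {0..}) \<and>
        (R has_vector_derivative ?A o\<^sub>L R t) (at t within {0..})" if "t \<ge> 0" for t
    proof (intro conjI)
      show "(s has_vector_derivative \<alpha> * s t) (at t within {0..})"
        using has_vector_derivative_transform[OF _ _ s'[of t], of s] eq that by simp
      show "(P has_vector_derivative 0) (at t within {0..})"
        using has_vector_derivative_transform[of t "{0..}" P "\<lambda>_. 0" 0] eq that by simp
      show "(Q has_vector_derivative B + (?A o\<^sub>L Q t) + (Q t o\<^sub>L D)) (at t within {0..})"
        using has_vector_derivative_transform[OF _ _ Q'[OF that], of Q] eq that by simp
      show "(R has_vector_derivative ?A o\<^sub>L R t) (at t within {0..})"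
        using has_vector_derivative_transform[OF _ _ R'[of t], of R] eq that by simp
    qed
    then show "(\<forall>t\<ge>0.
        (s has_vector_derivative \<alpha> * s t) (at t within {0..}) \<and>
        (P has_vector_derivative 0) (at t within {0..}) \<and>
        (Q has_vector_derivative B + (?A o\<^sub>L Q t) + (Q t o\<^sub>L D)) (at t within {0..}) \<and>
        (R has_vector_derivative ?A o\<^sub>L R t) (at t within {0..})) \<and>
        s 0 = 1 \<and> P 0 = 0 \<and> Q 0 = 0 \<and> R 0 = id_blinfun"
      using eq by simp
  qed
qed

end
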